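(* Let $(\Omega,\mathcal F)$ be a measurable space and $\mathfrak P$ a nonempty convex set of probability measures on it. Suppose that $\Phi=(\phi_{\mathbb P})_{\mathbb P\in\mathfrak P}$ is doubly penalised, i.e. $$\phi_{\mathbb P}(x)=\frac{\phi(\theta(\mathbb P)x)}{1+\gamma(\mathbb P)},\qquad x\ge0,\ \mathbb P\in\mathfrak P,$$ with a joint Orlicz function $\phi$, a multiplicative penalisation $\theta\colon\mathfrak P\to(0,\infty)$ with $\sup_{\mathbb P\in\mathfrak P}\theta(\mathbb P)<\infty$, and a convex additive penalty function $\gamma\colon\mathfrak P\to[0,\infty)$ with countably convex lower level sets. Then $$\mathfrak L^\Phi(\mathfrak P)=L^\Phi(\mathfrak P).$$
   Context: $L^0(\mathfrak P)$ is the space of equivalence classes $[f]$ of measurable functions $f\colon\Omega\to\mathbb R$ under $f\sim g\iff \mathbb P(f=g)=1$ for all $\mathbb P\in\mathfrak P$. An Orlicz function is a lower semicontinuous, nondecreasing, convex function $\phi\colon[0,\infty)\to[0,\infty]$ with $\phi(0)=0$ such that there are $x_0,x_1>0$ with $\phi(x_0)<\infty$ and $\phi(x_1)>0$. For a family $\Phi=(\phi_{\mathbb P})_{\mathbb P\in\mathfrak P}$ of Orlicz functions and $X\in L^0(\mathfrak P)$, $$\|X\|_{L^\Phi(\mathfrak P)}=\inf\Big\{\lambda>0:\ \sup_{\mathbb P\in\mathfrak P}\mathbb E_{\mathbb P}[\phi_{\mathbb P}(\lambda^{-1}|X|)]\le1\Big\}\in[0,\infty],\qquad L^\Phi(\mathfrak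 P)=\{X\in L^0(\mathfrak P): \|X\|_{L^\Phi(\mathfrak P)}<\infty\},$$ $$\mathfrak L^\Phi(\mathfrak P)=\{X\in L^0(\mathfrak P):\ \forall\,\mathbb P\in\mathfrak P\ \exists\,\alpha>0:\ \mathbb E_{\mathbb P}[\phi_{\mathbb P}(\alpha|X|)]<\infty\}.$$ The lower level sets of $\gamma$ are the sets $\{\mathbb P\in\mathfrak P:\gamma(\mathbb P)\le c\}$, $c\in\mathbb R$. A set $\mathfrak A$ of probability measures is countably convex if $\sum_n\lambda_n\mathbb P_n\in\mathfrak A$ for all sequences $(\mathbb P_n)_{n\in\mathbb N}\subset\mathfrak A$ and $\lambda_n\ge0$ with $\sum_n\lambda_n=1$. *)

theory Defs
  imports "HOL-Probability.Probability"
begin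

text \<open>A measure \<open>M\<close> represents a measurable space; its \<open>emeasure\<close> is irrelevant.\<close>

definition prob_measures_on :: "'a measure \<Rightarrow> 'a measure set" where
  "prob_measures_on M = {P. sets P = sets M \<and> prob_space P}"

definition mix_measure :: "'a measure \<Rightarrow> real \<Rightarrow> 'a measure \<Rightarrow> 'a measure \<Rightarrow> 'a measure" where
  "mix_measure M t P Q = measure_of (space M) (sets M)
     (\<lambda>A. ennreal (1 - t) * emeasure P A + ennreal t * emeasure Q A)"

definition countable_mix_measure ::
    "'a measure \<Rightarrow> (nat \<Rightarrow> real) \<Rightarrow> (nat \<Rightarrow> 'a measure) \<Rightarrow> 'a measure" where
  "countable_mix_measure M w P = measure_of (space M) (sets M)
     (\<lambda>A. \<Sum>n. ennreal (w n) * emeasure (P n) A)"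

lemma sets_mix_measure [simp]: "sets (mix_measure M t P Q) = sets M"
  by (simp add: mix_measure_def)

lemma sets_countable_mix_measure [simp]: "sets (countable_mix_measure M w P) = sets M"
  by (simp add: countable_mix_measure_def)

lemma emeasure_countable_mix_measure:
  assumes "\<And>n. sets (P n) = sets M" and A: "A \<in> sets M"
  shows "emeasure (countable_mix_measure M w P) A = (\<Sum>n. ennreal (w n) * emeasure (P n) A)"
  unfolding countable_mix_measure_def
proof (rule emeasure_measure_of_sigma[OF _ _ _ A])
  show "countably_additive (sets M) (\<lambda>A. \<Sum>n. ennreal (w n) * emeasure (P n) A)"
  proof (rule countably_additiveI)
    fix B :: "nat \<Rightarrow> 'a set"
    assume B: "range B \<subseteq> sets M" "disjoint_family B"
    have "(\<Sum>i. \<Sum>n. ennreal (w n) * emeasure (P n) (B i))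
        = (\<Sum>n. \<Sum>i. ennreal (w n) * emeasure (P n) (B i))"
      using nn_integral_suminf[of "\<lambda>i n. ennreal (w n) * emeasure (P n) (B i)" "count_space UNIV"]
      unfolding nn_integral_count_space_nat by simp
    also have "\<dots> = (\<Sum>n. ennreal (w n) * emeasure (P n) (\<Union> (range B)))"
      using B assms by (intro suminf_cong) (simp add: ennreal_suminf_cmult suminf_emeasure)
    finally show "(\<Sum>i. \<Sum>n. ennreal (w n) * emeasure (P n) (B i))
        = (\<Sum>n. ennreal (w n) * emeasure (P n) (\<Union> (range B)))" .
  qed
qed (auto simp: positive_def sets.sigma_algebra_axioms)

lemma mix_measure_eq_countable_mix_measure:
  "mix_measure M t P Q = countable_mix_measure M
     (\<lambda>n. if n = 0 then 1 - t else if n = 1 then t else 0) (\<lambda>n. if n = 0 then P else Q)"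
proof -
  have "(\<Sum>n. ennreal (if n = 0 then 1 - t else if n = 1 then t else 0) *
           emeasure (if n = 0 then P else Q) A)
      = ennreal (1 - t) * emeasure P A + ennreal t * emeasure Q A" for A
    by (subst suminf_finite[where N = "{0, 1}"]) auto
  then show ?thesis by (simp add: mix_measure_def countable_mix_measure_def)
qed

lemma emeasure_mix_measure:
  assumes "sets P = sets M" "sets Q = sets M" "A \<in> sets M"
  shows "emeasure (mix_measure M t P Q) A
    = ennreal (1 - t) * emeasure P A + ennreal t * emeasure Q A"
proof -
  have "emeasure (mix_measure M t P Q) A
    = (\<Sum>n. ennreal (if n = 0 then 1 - t else if n = 1 then t else 0) *
         emeasure (if n = 0 then P else Q) A)"
    unfolding mix_measure_eq_countable_mix_measure
    using assms by (intro emeasure_countable_mix_measure) auto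
  also have "\<dots> = ennreal (1 - t) * emeasure P A + ennreal t * emeasure Q A"
    by (subst suminf_finite[where N = "{0, 1}"]) auto
  finally show ?thesis .
qed

definition convex_measures :: "'a measure \<Rightarrow> 'a measure set \<Rightarrow> bool" where
  "convex_measures M \<PP> \<longleftrightarrow>
     (\<forall>P\<in>\<PP>. \<forall>Q\<in>\<PP>. \<forall>t\<in>{0..1}. mix_measure M t P Q \<in> \<PP>)"

definition countably_convex_measures :: "'a measure \<Rightarrow> 'a measure set \<Rightarrow> bool" where
  "countably_convex_measures M \<AA> \<longleftrightarrow>
     (\<forall>P w. range P \<subseteq> \<AA> \<longrightarrow> (\<forall>n. 0 \<le> w n) \<longrightarrow> w sums 1 \<longrightarrow> countable_mix_measure M w P \<in> \<AA>)"

definition convex_on_measures ::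
    "'a measure \<Rightarrow> 'a measure set \<Rightarrow> ('a measure \<Rightarrow> real) \<Rightarrow> bool" where
  "convex_on_measures M \<PP> \<gamma> \<longleftrightarrow>
     (\<forall>P\<in>\<PP>. \<forall>Q\<in>\<PP>. \<forall>t\<in>{0..1}. \<gamma> (mix_measure M t P Q) \<le> (1 - t) * \<gamma> P + t * \<gamma> Q)"

text \<open>Orlicz functions live on \<open>[0,\<infinity>)\<close>; their values at negative arguments are irrelevant.
  The punctured filter \<open>at x within {0..}\<close> gives the usual notion of lower semicontinuity.
  In \<^typ>\<open>ennreal\<close>, \<open>0 * \<infinity> = 0\<close>, so the convexity inequality is harmless for \<open>t \<in> {0, 1}\<close>.\<close>

definition orlicz_function :: "(real \<Rightarrow> ennreal) \<Rightarrow> bool" where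
  "orlicz_function \<phi> \<longleftrightarrow>
     (\<forall>x\<ge>0. \<phi> x \<le> Liminf (at x within {0..}) \<phi>) \<and>
     mono_on {0..} \<phi> \<and>
     (\<forall>x\<ge>0. \<forall>y\<ge>0. \<forall>t\<in>{0..1}.
        \<phi> ((1 - t) * x + t * y) \<le> ennreal (1 - t) * \<phi> x + ennreal t * \<phi> y) \<and>
     \<phi> 0 = 0 \<and>
     (\<exists>x>0. \<phi> x < \<infinity>) \<and>
     (\<exists>x>0. \<phi> x > 0)"

definition L0_rel :: "'a measure \<Rightarrow> 'a measure set \<Rightarrow> (('a \<Rightarrow> real) \<times> ('a \<Rightarrow> real)) set" where
  "L0_rel M \<PP> = {(f, g). f \<in> borel_measurable M \<and> g \<in> borel_measurable M \<and>
     (\<forall>P\<in>\<PP>. measure P {\<omega> \<in> space M. f \<omega> = g \<omega>} = 1)}"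

definition L0 :: "'a measure \<Rightarrow> 'a measure set \<Rightarrow> ('a \<Rightarrow> real) set set" where
  "L0 M \<PP> = borel_measurable M // L0_rel M \<PP>"

definition expect_class :: "'a measure \<Rightarrow> (real \<Rightarrow> ennreal) \<Rightarrow> ('a \<Rightarrow> real) set \<Rightarrow> ennreal" where
  "expect_class P h X = (\<integral>\<^sup>+ \<omega>. h ((SOME f. f \<in> X) \<omega>) \<partial>P)"

lemma L0_rel_AE:
  assumes "\<PP> \<subseteq> prob_measures_on M" "P \<in> \<PP>" "(f, g) \<in> L0_rel M \<PP>"
  shows "AE \<omega> in P. f \<omega> = g \<omega>"
proof -
  have P: "prob_space P" and s: "sets P = sets M"
    using assms by (auto simp: prob_measures_on_def)
  have [measurable]: "f \<in> borel_measurable M" "g \<in> borel_measurable M"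
    and m: "measure P {\<omega> \<in> space M. f \<omega> = g \<omega>} = 1"
    using assms by (auto simp: L0_rel_def)
  have "{\<omega> \<in> space M. f \<omega> = g \<omega>} \<in> sets P"
    unfolding s by measurable
  with m have "AE \<omega> in P. \<omega> \<in> {\<omega> \<in> space M. f \<omega> = g \<omega>}"
    using prob_space.prob_eq_1[OF P] by blast
  then show ?thesis by eventually_elim simp
qed

lemma equiv_L0_rel:
  assumes "\<PP> \<subseteq> prob_measures_on M"
  shows "equiv (borel_measurable M) (L0_rel M \<PP>)"
proof (rule equivI)
  show "L0_rel M \<PP> \<subseteq> borel_measurable M \<times> borel_measurable M"
    by (auto simp: L0_rel_def)
  have sp: "space P = space M" "prob_space P" "sets P = sets M" if "P \<in> \<PP>" for P
    using that assms by (auto simp: prob_measures_on_def dest: sets_eq_imp_space_eq)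
  show "refl_on (borel_measurable M) (L0_rel M \<PP>)"
    using sp by (auto simp: refl_on_def L0_rel_def) (metis prob_space.prob_space)
  show "sym (L0_rel M \<PP>)"
  proof (rule symI)
    fix f g assume "(f, g) \<in> L0_rel M \<PP>"
    moreover have "{\<omega> \<in> space M. g \<omega> = f \<omega>} = {\<omega> \<in> space M. f \<omega> = g \<omega>}" by auto
    ultimately show "(g, f) \<in> L0_rel M \<PP>" by (simp add: L0_rel_def)
  qed
  show "trans (L0_rel M \<PP>)"
  proof (rule transI)
    fix f g h assume fg: "(f, g) \<in> L0_rel M \<PP>" and gh: "(g, h) \<in> L0_rel M \<PP>"
    have [measurable]: "f \<in> borel_measurable M" "h \<in> borel_measurable M"
      using fg gh by (auto simp: L0_rel_def)
    have "measure P {\<omega> \<in> space M. f \<omega> = h \<omega>} = 1" if P: "P \<in> \<PP>" for P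
    proof -
      have "AE \<omega> in P. f \<omega> = h \<omega>"
        using L0_rel_AE[OF assms P fg] L0_rel_AE[OF assms P gh] by eventually_elim simp
      then have "AE \<omega> in P. \<omega> \<in> {\<omega> \<in> space M. f \<omega> = h \<omega>}"
        using AE_space by eventually_elim (simp add: sp[OF P])
      moreover have "{\<omega> \<in> space M. f \<omega> = h \<omega>} \<in> sets P"
        unfolding sp(3)[OF P] by measurable
      ultimately show ?thesis
        using prob_space.prob_eq_1[OF sp(2)[OF P]] by blast
    qed
    then show "(f, h) \<in> L0_rel M \<PP>" by (auto simp: L0_rel_def)
  qed
qed

text \<open>The expectation does not depend on the chosen representative.\<close>

lemma expect_class_eq:
  assumes "\<PP> \<subseteq> prob_measures_on M" "P \<in> \<PP>" "X \<in> L0 M \<PP>" "f \<in> X"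
  shows "expect_class P h X = (\<integral>\<^sup>+ \<omega>. h (f \<omega>) \<partial>P)"
proof -
  have "(SOME f. f \<in> X) \<in> X" using someI[of "\<lambda>f. f \<in> X", OF assms(4)] .
  then have "((SOME f. f \<in> X), f) \<in> L0_rel M \<PP>"
    using assms quotient_eq_iff[OF equiv_L0_rel[OF assms(1)], of X X "SOME f. f \<in> X" f]
    by (simp add: L0_def)
  from L0_rel_AE[OF assms(1,2) this]
  have "AE \<omega> in P. h ((SOME f. f \<in> X) \<omega>) = h (f \<omega>)"
    by eventually_elim simp
  then show ?thesis unfolding expect_class_def by (rule nn_integral_cong_AE)
qed

definition orlicz_norm ::
    "'a measure set \<Rightarrow> ('a measure \<Rightarrow> real \<Rightarrow> ennreal) \<Rightarrow> ('a \<Rightarrow> real) set \<Rightarrow> ennreal" where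
  "orlicz_norm \<PP> \<Phi> X =
     Inf {ennreal l | l. l > 0 \<and> (SUP P\<in>\<PP>. expect_class P (\<lambda>x. \<Phi> P (inverse l * \<bar>x\<bar>)) X) \<le> 1}"

definition orlicz_space ::
    "'a measure \<Rightarrow> 'a measure set \<Rightarrow> ('a measure \<Rightarrow> real \<Rightarrow> ennreal) \<Rightarrow> ('a \<Rightarrow> real) set set" where
  "orlicz_space M \<PP> \<Phi> = {X \<in> L0 M \<PP>. orlicz_norm \<PP> \<Phi> X < \<infinity>}"

definition weak_orlicz_space ::
    "'a measure \<Rightarrow> 'a measure set \<Rightarrow> ('a measure \<Rightarrow> real \<Rightarrow> ennreal) \<Rightarrow> ('a \<Rightarrow> real) set set" where
  "weak_orlicz_space M \<PP> \<Phi> =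
     {X \<in> L0 M \<PP>. \<forall>P\<in>\<PP>. \<exists>\<alpha>>0. expect_class P (\<lambda>x. \<Phi> P (\<alpha> * \<bar>x\<bar>)) X < \<infinity>}"

definition doubly_penalised ::
    "'a measure set \<Rightarrow> ('a measure \<Rightarrow> real \<Rightarrow> ennreal) \<Rightarrow> (real \<Rightarrow> ennreal) \<Rightarrow>
      ('a measure \<Rightarrow> real) \<Rightarrow> ('a measure \<Rightarrow> real) \<Rightarrow> bool" where
  "doubly_penalised \<PP> \<Phi> \<phi> \<theta> \<gamma> \<longleftrightarrow>
     (\<forall>P\<in>\<PP>. \<forall>x\<ge>0. \<Phi> P x = \<phi> (\<theta> P * x) / ennreal (1 + \<gamma> P))"

end

theory Submission
  imports Defs
begin

text \<open>If \<open>X\<close> has infinite norm, then for every \<open>n\<close> some \<open>P\<^sub>n\<close> gives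
  \<open>\<phi>(4\<^sup>-\<^sup>n|X|)\<close> an expectation above \<open>1 + \<gamma>(P\<^sub>n)\<close>, because \<open>\<theta>\<close> is bounded. Mixing \<open>P\<^sub>n\<close> with
  weight \<open>1/(1 + \<gamma>(P\<^sub>n))\<close> into a fixed \<open>P\<^sub>0\<close> yields \<open>Q\<^sub>n\<close> with \<open>\<gamma>(Q\<^sub>n) \<le> \<gamma>(P\<^sub>0) + 1\<close> that still
  gives it an expectation above 1. By convexity of \<open>\<phi>\<close>, the \<open>Q\<^sub>n\<close>-expectation of \<open>\<phi>(\<beta>|X|)\<close> is
  then of order \<open>4\<^sup>n\<close> for each fixed \<open>\<beta> > 0\<close>, hence infinite under the mixture of the \<open>Q\<^sub>n\<close> with
  weights \<open>2\<^sup>-\<^sup>n\<^sup>-\<^sup>1\<close>. This mixture lies in the same level set of \<open>\<gamma>\<close>, so \<open>X\<close> is not in the weak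
  space.\<close>

lemma orlicz_function_mono:
  assumes "orlicz_function \<phi>" "0 \<le> x" "x \<le> y"
  shows "\<phi> x \<le> \<phi> y"
  using assms by (auto simp: orlicz_function_def mono_on_def)

lemma orlicz_function_scale:
  assumes "orlicz_function \<phi>" "0 \<le> x" "s \<in> {0..1}"
  shows "\<phi> (s * x) \<le> ennreal s * \<phi> x"
proof -
  have "\<phi> ((1 - s) * 0 + s * x) \<le> ennreal (1 - s) * \<phi> 0 + ennreal s * \<phi> x"
    using assms unfolding orlicz_function_def by blast
  then show ?thesis using assms(1) by (simp add: orlicz_function_def)
qed

text \<open>Superlevel sets of a monotone function are intervals. The codomain is kept general
  because \<phi> may take the value \<infinity>.\<close>

lemma borel_measurable_mono_linorder:
  fixes f :: "real \<Rightarrow> 'b::{linorder_topology, second_countable_topology}"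
  assumes "mono f"
  shows "f \<in> borel_measurable borel"
proof (rule borel_measurableI_greater)
  fix y
  have "is_interval {x \<in> space borel. y < f x}"
    unfolding is_interval_1 using assms by (auto dest: monoD intro: less_le_trans)
  then show "{x \<in> space borel. y < f x} \<in> sets borel"
    by (rule real_interval_borel_measurable)
qed

lemma borel_measurable_orlicz_comp:
  assumes \<phi>: "orlicz_function \<phi>" and [measurable]: "f \<in> borel_measurable M" and "0 \<le> s"
  shows "(\<lambda>\<omega>. \<phi> (s * \<bar>f \<omega>\<bar>)) \<in> borel_measurable M"
proof -
  \<comment> \<open>Truncation at 0 gives a function monotone on the whole line; \<phi> itself is
    arbitrary at negative arguments.\<close>
  have [measurable]: "(\<lambda>x. \<phi> (max 0 x)) \<in> borel_measurable borel"
    by (intro borel_measurable_mono_linorder monoI orlicz_function_mono[OF \<phi>]) auto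
  have "(\<lambda>\<omega>. \<phi> (max 0 (s * \<bar>f \<omega>\<bar>))) \<in> borel_measurable M"
    by measurable
  then show ?thesis using \<open>0 \<le> s\<close> by (simp add: max_def)
qed

text \<open>Setwise domination is the order on measures, in which the integral is monotone. A
  mixture dominates each weighted component, so its integrals are bounded below without being
  computed.\<close>

lemma cmult_nn_integral_le_measure:
  assumes sets: "sets P = sets Q" and f: "f \<in> borel_measurable P"
    and le: "\<And>A. A \<in> sets P \<Longrightarrow> c * emeasure P A \<le> emeasure Q A"
  shows "c * nn_integral P f \<le> nn_integral Q f"
proof -
  have "scale_measure c P \<le> Q"
  \<comment> \<open>The order on measures is lexicographic in space, sigma-algebra and
    \<open>emeasure\<close>; this is the case where the first two agree.\<close>
  proof (rule less_eq_measure.intros(3))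
    show "space (scale_measure c P) = space Q"
      using sets_eq_imp_space_eq[OF sets] by (simp add: space_scale_measure)
    show "emeasure (scale_measure c P) \<le> emeasure Q"
    proof (rule le_funI)
      fix A show "emeasure (scale_measure c P) A \<le> emeasure Q A"
        using le[of A] by (cases "A \<in> sets P") (auto simp: emeasure_notin_sets)
    qed
  qed (simp add: sets)
  then have "nn_integral (scale_measure c P) f \<le> nn_integral Q f"
    by (intro nn_integral_mono_measure) (simp_all add: sets)
  then show ?thesis by (simp add: nn_integral_scale_measure f)
qed

lemma nn_integral_mix_measure_ge:
  assumes "sets P = sets M" "sets Q = sets M" "f \<in> borel_measurable M"
  shows "ennreal t * nn_integral Q f \<le> nn_integral (mix_measure M t P Q) f"
proof (rule cmult_nn_integral_le_measure)
  show "f \<in> borel_measurable Q"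
    using assms by (simp cong: measurable_cong_sets)
qed (simp_all add: assms emeasure_mix_measure)

lemma nn_integral_countable_mix_measure_ge:
  assumes "\<And>n. sets (P n) = sets M" "f \<in> borel_measurable M"
  shows "ennreal (w n) * nn_integral (P n) f \<le> nn_integral (countable_mix_measure M w P) f"
proof (rule cmult_nn_integral_le_measure)
  show "f \<in> borel_measurable (P n)"
    using assms by (simp cong: measurable_cong_sets)
  fix A assume "A \<in> sets (P n)"
  then have "A \<in> sets M" by (simp add: assms)
  have "ennreal (w n) * emeasure (P n) A = (\<Sum>n\<in>{n}. ennreal (w n) * emeasure (P n) A)"
    by simp
  also have "\<dots> \<le> (\<Sum>n. ennreal (w n) * emeasure (P n) A)"
    by (rule sum_le_suminf) auto
  finally show "ennreal (w n) * emeasure (P n) A \<le> emeasure (countable_mix_measure M w P) A"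
    using assms(1) \<open>A \<in> sets M\<close> by (simp add: emeasure_countable_mix_measure)
qed (simp add: assms)

lemma L0_borel_measurable:
  assumes "X \<in> L0 M \<PP>" "f \<in> X"
  shows "f \<in> borel_measurable M"
proof -
  obtain g where "X = L0_rel M \<PP> `` {g}"
    using assms(1) unfolding L0_def by (rule quotientE)
  then show ?thesis using assms(2) by (auto simp: L0_rel_def)
qed

text \<open>A scale \<open>l\<close> admissible for the norm serves every P at once, with \<alpha> =
  1/l.\<close>

lemma orlicz_space_subset_weak_orlicz_space:
  "orlicz_space M \<PP> \<Phi> \<subseteq> weak_orlicz_space M \<PP> \<Phi>"
proof
  fix X assume X: "X \<in> orlicz_space M \<PP> \<Phi>"
  then have "orlicz_norm \<PP> \<Phi> X < \<infinity>" by (simp add: orlicz_space_def)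
  then obtain l where l: "l > 0"
      "(SUP P\<in>\<PP>. expect_class P (\<lambda>x. \<Phi> P (inverse l * \<bar>x\<bar>)) X) \<le> 1"
    unfolding orlicz_norm_def Inf_less_iff by auto
  have "expect_class P (\<lambda>x. \<Phi> P (inverse l * \<bar>x\<bar>)) X < \<infinity>" if "P \<in> \<PP>" for P
    using l(2) that by (auto simp: SUP_le_iff intro: le_less_trans[of _ 1])
  with l(1) X show "X \<in> weak_orlicz_space M \<PP> \<Phi>"
    unfolding weak_orlicz_space_def orlicz_space_def
    using positive_imp_inverse_positive by blast
qed

lemma mix_into_level_set:
  assumes \<PP>: "\<PP> \<subseteq> prob_measures_on M" "convex_measures M \<PP>"
    and \<gamma>: "\<And>P. P \<in> \<PP> \<Longrightarrow> 0 \<le> \<gamma> P" "convex_on_measures M \<PP> \<gamma>"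
    and P: "P\<^sub>0 \<in> \<PP>" "P \<in> \<PP>" and g: "g \<in> borel_measurable M"
  obtains Q where "Q \<in> {P \<in> \<PP>. \<gamma> P \<le> \<gamma> P\<^sub>0 + 1}"
    "nn_integral P g / ennreal (1 + \<gamma> P) \<le> nn_integral Q g"
proof -
  \<comment> \<open>This weight turns the penalty quotient into a mixing weight, while P adds at
    most 1 to \<gamma> of the mixture.\<close>
  define t where "t = 1 / (1 + \<gamma> P)"
  have t: "t \<in> {0..1}" "t * \<gamma> P \<le> 1"
    using \<gamma>(1)[OF P(2)] by (auto simp: t_def field_simps)
  have "\<gamma> (mix_measure M t P\<^sub>0 P) \<le> (1 - t) * \<gamma> P\<^sub>0 + t * \<gamma> P"
    using \<gamma>(2) P t(1) unfolding convex_on_measures_def by blast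
  also have "\<dots> \<le> 1 * \<gamma> P\<^sub>0 + 1"
    using t \<gamma>(1)[OF P(1)] by (intro add_mono mult_right_mono) auto
  finally have "mix_measure M t P\<^sub>0 P \<in> {P \<in> \<PP>. \<gamma> P \<le> \<gamma> P\<^sub>0 + 1}"
    using \<PP>(2) P t(1) by (simp add: convex_measures_def)
  moreover have "nn_integral P g / ennreal (1 + \<gamma> P) \<le> nn_integral (mix_measure M t P\<^sub>0 P) g"
  proof -
    have "ennreal t = inverse (ennreal (1 + \<gamma> P))"
      using \<gamma>(1)[OF P(2)] by (subst inverse_ennreal) (simp_all add: t_def inverse_eq_divide)
    then have "nn_integral P g / ennreal (1 + \<gamma> P) = ennreal t * nn_integral P g"
      by (simp only: divide_ennreal_def mult.commute)
    also have "\<dots> \<le> nn_integral (mix_measure M t P\<^sub>0 P) g"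
      using \<PP>(1) P g by (intro nn_integral_mix_measure_ge) (auto simp: prob_measures_on_def)
    finally show ?thesis .
  qed
  ultimately show ?thesis by (rule that)
qed

lemma orlicz_mixture_infinite:
  assumes \<phi>: "orlicz_function \<phi>" and f: "f \<in> borel_measurable M"
    and Q: "\<And>n. sets (Q n) = sets M"
    and large: "\<And>n. 1 < (\<integral>\<^sup>+ \<omega>. \<phi> ((1 / 4) ^ n * \<bar>f \<omega>\<bar>) \<partial>Q n)"
    and \<beta>: "0 < \<beta>"
  shows "(\<integral>\<^sup>+ \<omega>. \<phi> (\<beta> * \<bar>f \<omega>\<bar>) \<partial>countable_mix_measure M (\<lambda>n. (1 / 2) ^ Suc n) Q) = \<infinity>"
proof (rule ccontr)
  let ?R = "countable_mix_measure M (\<lambda>n. (1 / 2) ^ Suc n) Q"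
  let ?g = "\<lambda>\<omega>. \<phi> (\<beta> * \<bar>f \<omega>\<bar>)"
  have g: "?g \<in> borel_measurable M"
    using borel_measurable_orlicz_comp[OF \<phi> f] \<beta> by simp
  assume "nn_integral ?R ?g \<noteq> \<infinity>"
  then obtain c where c: "nn_integral ?R ?g = ennreal c" "0 \<le> c"
    by (cases "nn_integral ?R ?g") auto
  \<comment> \<open>The bound 1/\<beta> makes s at most 1, so that convexity applies; the bound
    2c/\<beta> yields the contradiction.\<close>
  obtain n where n: "max (2 * c / \<beta>) (1 / \<beta>) < 2 ^ n"
    using real_arch_pow[of 2 "max (2 * c / \<beta>) (1 / \<beta>)"] by auto
  define s where "s = (1 / 4) ^ n / \<beta>"
  have "1 / \<beta> < 2 ^ n" using n by simp
  also have "(2::real) ^ n \<le> 4 ^ n" by (rule power_mono) auto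
  finally have s: "s \<in> {0..1}" "s * \<beta> = (1 / 4) ^ n"
    using \<beta> by (auto simp: s_def field_simps)
  \<comment> \<open>Undoing the mixture weight costs a factor of order 2^n, but s decays like 4^-n;
    hence base 4 against base 2.\<close>
  have "2 ^ Suc n * s = 2 / (\<beta> * 2 ^ n)"
    using \<beta> power_mult_distrib[of "2::real" 2 n] by (simp add: s_def field_simps)
  then have "2 ^ Suc n * s * c = 2 * c / (\<beta> * 2 ^ n)" by simp
  also have "\<dots> < 1" using n \<beta> by (simp add: field_simps)
  finally have small: "2 ^ Suc n * s * c < 1" .
  have "1 < (\<integral>\<^sup>+ \<omega>. \<phi> (s * (\<beta> * \<bar>f \<omega>\<bar>)) \<partial>Q n)"
    using large[of n] by (simp add: s(2) mult.assoc[symmetric])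
  also have "\<dots> \<le> (\<integral>\<^sup>+ \<omega>. ennreal s * ?g \<omega> \<partial>Q n)"
    using s(1) \<beta> by (intro nn_integral_mono orlicz_function_scale[OF \<phi>]) auto
  also have "\<dots> = ennreal s * nn_integral (Q n) ?g"
    using g Q by (intro nn_integral_cmult) (simp cong: measurable_cong_sets)
  also have "\<dots> = ennreal (2 ^ Suc n * s) * (ennreal ((1 / 2) ^ Suc n) * nn_integral (Q n) ?g)"
  proof -
    have "2 ^ Suc n * s * (1 / 2) ^ Suc n = s" by (simp add: power_divide)
    then have "ennreal s = ennreal (2 ^ Suc n * s) * ennreal ((1 / 2) ^ Suc n)"
      using s(1) by (subst ennreal_mult[symmetric]) simp_all
    then show ?thesis by (simp only: mult.assoc)
  qed
  also have "\<dots> \<le> ennreal (2 ^ Suc n * s) * ennreal c"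
    using nn_integral_countable_mix_measure_ge[of Q M ?g "\<lambda>n. (1 / 2) ^ Suc n" n, OF Q g]
    by (intro mult_left_mono) (simp_all only: c(1) zero_le)
  also have "\<dots> = ennreal (2 ^ Suc n * s * c)"
    using s(1) c(2) by (simp add: ennreal_mult)
  finally have "1 < ennreal (2 ^ Suc n * s * c)" .
  then show False using small ennreal_less_one_iff less_asym by blast
qed

theorem theorem3p13:
  fixes M :: "'a measure"
    and \<PP> :: "'a measure set"
    and \<Phi> :: "'a measure \<Rightarrow> real \<Rightarrow> ennreal"
    and \<phi> :: "real \<Rightarrow> ennreal"
    and \<theta> \<gamma> :: "'a measure \<Rightarrow> real"
  assumes "\<PP> \<noteq> {}"
    and "\<PP> \<subseteq> prob_measures_on M"
    and "convex_measures M \<PP>"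
    and "orlicz_function \<phi>"
    and "\<And>P. P \<in> \<PP> \<Longrightarrow> 0 < \<theta> P"
    and "bdd_above (\<theta> ` \<PP>)"
    and "\<And>P. P \<in> \<PP> \<Longrightarrow> 0 \<le> \<gamma> P"
    and "convex_on_measures M \<PP> \<gamma>"
    and "\<And>c::real. countably_convex_measures M {P \<in> \<PP>. \<gamma> P \<le> c}"
    and "doubly_penalised \<PP> \<Phi> \<phi> \<theta> \<gamma>"
  shows "weak_orlicz_space M \<PP> \<Phi> = orlicz_space M \<PP> \<Phi>"
proof (rule antisym[OF _ orlicz_space_subset_weak_orlicz_space], rule subsetI, rule ccontr)
  fix X assume weak: "X \<in> weak_orlicz_space M \<PP> \<Phi>" and "X \<notin> orlicz_space M \<PP> \<Phi>"
  then have X: "X \<in> L0 M \<PP>" and norm: "orlicz_norm \<PP> \<Phi> X = \<infinity>"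
    by (auto simp: weak_orlicz_space_def orlicz_space_def less_top[symmetric])
  obtain f where "f \<in> X"
    using X in_quotient_imp_non_empty[OF equiv_L0_rel[OF assms(2)]] unfolding L0_def by blast
  note f = L0_borel_measurable[OF X this]
  have sets: "sets P = sets M" if "P \<in> \<PP>" for P
    using that assms(2) by (auto simp: prob_measures_on_def)
  have expect: "expect_class P (\<lambda>x. \<Phi> P (a * \<bar>x\<bar>)) X
      = (\<integral>\<^sup>+ \<omega>. \<phi> (\<theta> P * a * \<bar>f \<omega>\<bar>) \<partial>P) / ennreal (1 + \<gamma> P)" if P: "P \<in> \<PP>" and "0 \<le> a" for P a
  proof -
    have "(\<lambda>\<omega>. \<phi> (\<theta> P * a * \<bar>f \<omega>\<bar>)) \<in> borel_measurable P"
      using borel_measurable_orlicz_comp[OF assms(4) f] assms(5)[OF P] \<open>0 \<le> a\<close> sets[OF P]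
      by (simp cong: measurable_cong_sets)
    then show ?thesis
      using assms(10) P \<open>0 \<le> a\<close> expect_class_eq[OF assms(2) P X \<open>f \<in> X\<close>]
      by (simp add: doubly_penalised_def nn_integral_divide mult.assoc)
  qed

  obtain P\<^sub>0 where P\<^sub>0: "P\<^sub>0 \<in> \<PP>" using assms(1) by blast
  obtain K where K: "\<theta> P \<le> K" if "P \<in> \<PP>" for P
    using assms(6) by (auto simp: bdd_above_def)
  have "0 < K" using assms(5)[OF P\<^sub>0] K[OF P\<^sub>0] by simp
  let ?\<LL> = "{P \<in> \<PP>. \<gamma> P \<le> \<gamma> P\<^sub>0 + 1}"
  have "\<exists>Q\<in>?\<LL>. 1 < (\<integral>\<^sup>+ \<omega>. \<phi> ((1 / 4) ^ n * \<bar>f \<omega>\<bar>) \<partial>Q)" for n :: nat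
  proof -
    \<comment> \<open>As \<theta> is at most K, \<theta>(P)/l is at most 4^-n for every P.\<close>
    define l where "l = K * 4 ^ n"
    have "0 < l" using \<open>0 < K\<close> by (simp add: l_def)
    \<comment> \<open>An admissible \<open>l\<close> would bound the infinite norm.\<close>
    have "\<not> (SUP P\<in>\<PP>. expect_class P (\<lambda>x. \<Phi> P (inverse l * \<bar>x\<bar>)) X) \<le> 1"
    proof
      assume "(SUP P\<in>\<PP>. expect_class P (\<lambda>x. \<Phi> P (inverse l * \<bar>x\<bar>)) X) \<le> 1"
      then have "orlicz_norm \<PP> \<Phi> X \<le> ennreal l"
        unfolding orlicz_norm_def using \<open>0 < l\<close> by (intro Inf_lower) blast
      then show False using norm by (simp add: top_unique)
    qed
    then obtain P where P: "P \<in> \<PP>" "1 < expect_class P (\<lambda>x. \<Phi> P (inverse l * \<bar>x\<bar>)) X"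
      by (auto simp: not_le less_SUP_iff)
    have scale: "\<theta> P * inverse l \<le> (1 / 4) ^ n" "0 \<le> \<theta> P * inverse l"
      using K[OF P(1)] assms(5)[OF P(1)] \<open>0 < K\<close> by (auto simp: l_def field_simps)
    have "1 < (\<integral>\<^sup>+ \<omega>. \<phi> (\<theta> P * inverse l * \<bar>f \<omega>\<bar>) \<partial>P) / ennreal (1 + \<gamma> P)"
      using P \<open>0 < l\<close> by (simp add: expect)
    also have "\<dots> \<le> (\<integral>\<^sup>+ \<omega>. \<phi> ((1 / 4) ^ n * \<bar>f \<omega>\<bar>) \<partial>P) / ennreal (1 + \<gamma> P)"
      using scale
      by (intro divide_right_mono_ennreal nn_integral_mono orlicz_function_mono[OF assms(4)]
          mult_right_mono mult_nonneg_nonneg[OF scale(2)]) auto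
    finally have "1 < (\<integral>\<^sup>+ \<omega>. \<phi> ((1 / 4) ^ n * \<bar>f \<omega>\<bar>) \<partial>P) / ennreal (1 + \<gamma> P)" .
    moreover have "(\<lambda>\<omega>. \<phi> ((1 / 4) ^ n * \<bar>f \<omega>\<bar>)) \<in> borel_measurable M"
      using borel_measurable_orlicz_comp[OF assms(4) f] by simp
    ultimately show ?thesis
      using mix_into_level_set[OF assms(2,3,7,8) P\<^sub>0 P(1)] by (metis (no_types, lifting) less_le_trans)
  qed
  then obtain Q where Q: "\<And>n. Q n \<in> ?\<LL>"
      "\<And>n. 1 < (\<integral>\<^sup>+ \<omega>. \<phi> ((1 / 4) ^ n * \<bar>f \<omega>\<bar>) \<partial>Q n)"
    by metis
  define R where "R = countable_mix_measure M (\<lambda>n. (1 / 2) ^ Suc n) Q"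
  \<comment> \<open>The level \<gamma>(\<open>P\<^sub>0\<close>) + 1 does not depend on n, so
    countable convexity of a single level set suffices. The exponent \<open>Suc n\<close> makes the
    weights sum to 1 from index 0.\<close>
  have "R \<in> ?\<LL>"
    using assms(9)[of "\<gamma> P\<^sub>0 + 1"] Q(1) power_half_series
    unfolding countably_convex_measures_def R_def by (auto simp: image_subset_iff)
  then have R: "R \<in> \<PP>" by simp
  then obtain \<alpha> where \<alpha>: "\<alpha> > 0" "expect_class R (\<lambda>x. \<Phi> R (\<alpha> * \<bar>x\<bar>)) X < \<infinity>"
    using weak by (auto simp: weak_orlicz_space_def)
  \<comment> \<open>Here \<beta> = \<theta>(R)\<alpha>. Dividing by the finite 1 + \<gamma>(R)
    leaves the expectation infinite, against the choice of \<alpha>.\<close>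
  have "(\<integral>\<^sup>+ \<omega>. \<phi> (\<theta> R * \<alpha> * \<bar>f \<omega>\<bar>) \<partial>R) = \<infinity>"
    unfolding R_def
    using Q sets \<alpha>(1) assms(5)[OF R]
    by (intro orlicz_mixture_infinite[OF assms(4) f]) (auto simp: R_def)
  then show False
    using \<alpha> R by (simp add: expect ennreal_top_divide)
qed

end
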